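(* The graph $OTIS(BF(4,6))$ is not Hamiltonian.
   Context: All graphs are finite, simple and undirected. The bowtie graph $BF(4,6)$ consists of a 4-cycle and a 6-cycle sharing exactly one vertex: its vertex set is $\{1,2,\dots,9\}$, the vertices $1,2,3,4$ form in this cyclic order a 4-cycle, the vertices $4,5,6,7,8,9$ form in this cyclic order a 6-cycle, and there are no other edges. For a graph $G$, the graph $OTIS(G)$ has vertex set $\{\langle u,v\rangle : u,v\in V(G)\}$ and edge set $$\{(\langle v,u\rangle,\langle v,u'\rangle) : v\in V(G),\ (u,u')\in E(G)\}\ \cup\ \{(\langle v,u\rangle,\langle u,v\rangle) : u,v\in V(G),\ u\ne v\}.$$ A graph is Hamiltonian if it has a cycle passing through every vertex exactly once. *)

theory Defs
  imports "Graph_Theory.Graph_Theory"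
begin

text \<open>
  Following the AFP entry, a finite simple undirected graph is a finite loop-free digraph with a
  symmetric arc relation (locale \<^locale>\<open>pair_graph\<close>); an undirected edge between \<open>u\<close> and \<open>v\<close>
  is the pair of arcs \<open>(u, v)\<close> and \<open>(v, u)\<close>.
\<close>

definition bowtie_4_6 :: "nat pair_pre_digraph" where
  "bowtie_4_6 =
    (let E = {(1, 2), (2, 3), (3, 4), (4, 1)} \<union>
             {(4, 5), (5, 6), (6, 7), (7, 8), (8, 9), (9, 4)}
     in \<lparr> pverts = {1..9}, parcs = E \<union> E\<inverse> \<rparr>)"

definition OTIS :: "'a pair_pre_digraph \<Rightarrow> ('a \<times> 'a) pair_pre_digraph" where
  "OTIS G = \<lparr> pverts = pverts G \<times> pverts G,
     parcs = {((v, u), (v, u')) | v u u'. v \<in> pverts G \<and> (u, u') \<in> parcs G} \<union>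
             {((v, u), (u, v)) | u v. u \<in> pverts G \<and> v \<in> pverts G \<and> u \<noteq> v} \<rparr>"

text \<open>
  \<^const>\<open>pre_digraph.cycle\<close> is a nonempty closed walk without repeated vertices. In a symmetric
  digraph it admits the walk \<open>a, b, a\<close>, which is not a cycle of the undirected graph; the
  length bound excludes it. The vertices on a closed walk are the tails of its arcs.
\<close>

definition hamiltonian_cycle :: "('a, 'b) pre_digraph \<Rightarrow> 'b awalk \<Rightarrow> bool" where
  "hamiltonian_cycle G p \<longleftrightarrow>
     pre_digraph.cycle G p \<and> 3 \<le> length p \<and> tail G ` set p = verts G"

definition hamiltonian :: "('a, 'b) pre_digraph \<Rightarrow> bool" where
  "hamiltonian G \<longleftrightarrow> (\<exists>p. hamiltonian_cycle G p)"

lemma pair_graph_bowtie_4_6: "pair_graph bowtie_4_6"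
  by unfold_locales
    (auto simp: bowtie_4_6_def Let_def symmetric_def sym_def simp del: One_nat_def)

lemma pair_graph_OTIS:
  assumes "pair_graph G"
  shows "pair_graph (OTIS G)"
proof -
  interpret pair_graph G by fact
  have "sym (parcs G)"
    using sym_arcs by (simp add: symmetric_def)
  moreover have "finite (parcs (OTIS G))"
  proof (rule finite_subset)
    show "parcs (OTIS G) \<subseteq> (pverts G \<times> pverts G) \<times> (pverts G \<times> pverts G)"
      by (auto simp: OTIS_def dest: in_arcsD1 in_arcsD2)
  qed simp
  ultimately show ?thesis
    by unfold_locales
      (auto simp: OTIS_def symmetric_def sym_def dest: in_arcsD1 in_arcsD2 no_loops')
qed

end

theory Submission
  imports Defs
begin

text \<open>
  The edges of a Hamiltonian cycle meet every vertex exactly twice, and no shorter cycle can be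
  formed from them. The degree conditions alone force all edges of one of four cycles, of lengths
  4, 4, 8 and 9, to be used, which is impossible in a graph with 81 vertices. That implication is
  propositional, with one variable per edge, and has a short resolution proof.
\<close>

lemma pcas_append: "pcas u (p @ q) w \<longleftrightarrow> (\<exists>v. pcas u p v \<and> pcas v q w)"
  by (induction p arbitrary: u) auto

text \<open>Both sides are the vertex sequence of the walk, read off from tails and from
  heads.\<close>

lemma pcas_fst_snd: "pcas u p v \<Longrightarrow> map fst p @ [v] = u # map snd p"
  by (induction u p v rule: pcas.induct) auto

lemma pcas_closed:
  assumes "pcas u p v" "u \<in> S" "\<forall>(x, y)\<in>set p. x \<in> S \<longrightarrow> y \<in> S"
  shows "v \<in> S \<and> fst ` set p \<subseteq> S"
  using assms by (induction u p v rule: pcas.induct) fastforce+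

text \<open>The part of the walk after \<open>x\<close> stays in \<open>S\<close> up to the base
  point \<open>u\<close>; restarting from \<open>u\<close> then keeps the whole walk in
  \<open>S\<close>.\<close>

lemma closed_pcas_closed:
  assumes "pcas u p u" "x \<in> S" "x \<in> fst ` set p" "\<forall>(x, y)\<in>set p. x \<in> S \<longrightarrow> y \<in> S"
  shows "fst ` set p \<subseteq> S"
proof -
  obtain q e r where p: "p = q @ e # r" and e: "fst e = x"
    using assms(3) by (metis imageE split_list)
  then have "pcas x (e # r) u"
    using assms(1) by (auto simp: pcas_append)
  then have "u \<in> S"
    using pcas_closed[of x "e # r" u S] assms(2,4) p by auto
  then show ?thesis
    using pcas_closed[OF assms(1)] assms(4) by blast
qed

lemma card_2_not_three:
  assumes "card {y. P y} = 2" "a \<noteq> b" "P a" "P b" "P c"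
  shows "c = a \<or> c = b"
proof -
  have "finite {y. P y}"
    using assms(1) card.infinite by fastforce
  then have "{a, b} = {y. P y}"
    by (rule card_subset_eq) (use assms in auto)
  then show ?thesis
    using assms(5) by blast
qed

text \<open>The witnesses are the cyclic successor and predecessor of \<open>x\<close>; three
  distinct entries suffice to keep them apart.\<close>

lemma cycle_two_neighbours:
  assumes "symp H" "distinct cs" "3 \<le> length cs" "list_all2 H cs (rotate1 cs)" "x \<in> set cs"
  shows "\<exists>a\<in>set cs. \<exists>b\<in>set cs. a \<noteq> b \<and> H x a \<and> H x b"
proof -
  let ?n = "length cs"
  have step: "H (cs ! i) (cs ! (Suc i mod ?n))" if "i < ?n" for i
    using assms(4) that by (simp add: list_all2_conv_all_nth nth_rotate1)
  obtain i where i: "i < ?n" "x = cs ! i"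
    using assms(5) by (metis in_set_conv_nth)
  define j where "j = (if i = 0 then ?n - 1 else i - 1)"
  have j: "j < ?n" "Suc j mod ?n = i" "Suc i mod ?n < ?n"
    using i(1) assms(3) by (auto simp: j_def mod_Suc)
  have "Suc i mod ?n \<noteq> j"
    using i(1) assms(3) by (auto simp: j_def mod_Suc)
  then have "cs ! (Suc i mod ?n) \<noteq> cs ! j"
    using assms(2) j by (simp add: nth_eq_iff_index_eq)
  moreover have "H x (cs ! (Suc i mod ?n))" "H x (cs ! j)"
    using step[of i] step[of j] i j assms(1) by (auto dest: sympD)
  ultimately show ?thesis
    using j by (meson nth_mem)
qed

text \<open>Trades the directed closed walk for its undirected edges. The last property is the only
  global one: no cycle of chosen edges misses a vertex.\<close>

lemma hamiltonian_edge_relation: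
  assumes "hamiltonian (with_proj G)"
  obtains H where
    "\<And>x y. H x y \<longleftrightarrow> H y x"
    "\<And>x y. H x y \<Longrightarrow> (x, y) \<in> parcs G \<or> (y, x) \<in> parcs G"
    "\<And>x. x \<in> pverts G \<Longrightarrow> card {y. H x y} = 2"
    "\<And>cs. distinct cs \<Longrightarrow> 3 \<le> length cs \<Longrightarrow> set cs \<subseteq> pverts G \<Longrightarrow> list_all2 H cs (rotate1 cs) \<Longrightarrow>
      set cs = pverts G"
proof -
  obtain p u where p: "pcas u p u" "distinct (tl (pawalk_verts u p))" "p \<noteq> []" "3 \<le> length p"
    and arcs: "set p \<subseteq> parcs G" and verts: "fst ` set p = pverts G"
    using assms
    by (auto simp: hamiltonian_def hamiltonian_cycle_def pre_digraph.cycle_def pre_digraph.awalk_def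
        cas_with_proj_eq awalk_verts_with_proj_eq)
  have dist_snd: "distinct (map snd p)"
    using p pre_digraph.awalk_verts_conv'[of "with_proj G" u p u]
    by (simp add: cas_with_proj_eq awalk_verts_with_proj_eq)
  have ends: "map fst p @ [u] = u # map snd p"
    using p(1) by (rule pcas_fst_snd)
  \<comment> \<open>Cancelling \<open>u\<close> shows that tails and heads agree as multisets, so
    distinctness and coverage pass between them.\<close>
  then have mset_ends: "mset (map fst p) = mset (map snd p)"
    by (metis add_mset_add_single add_right_imp_eq mset.simps mset_append)
  have dist_fst: "distinct (map fst p)"
    using dist_snd mset_ends by (metis mset_eq_imp_distinct_iff)
  have snd_verts: "snd ` set p = pverts G"
    using mset_ends verts by (metis list.set_map mset_eq_setD)
  have succ_unique: "y = z" if "(x, y) \<in> set p" "(x, z) \<in> set p" for x y z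
    using dist_fst that inj_onD[of fst "set p" "(x, y)" "(x, z)"] by (simp add: distinct_map)
  have pred_unique: "y = z" if "(y, x) \<in> set p" "(z, x) \<in> set p" for x y z
    using dist_snd that inj_onD[of snd "set p" "(y, x)" "(z, x)"] by (simp add: distinct_map)
  have card_verts: "3 \<le> card (pverts G)"
    using dist_fst p(4) verts by (metis distinct_card length_map list.set_map)
  have closed: "pverts G \<subseteq> S"
    if "x \<in> S" "x \<in> pverts G" "\<forall>(x, y)\<in>set p. x \<in> S \<longrightarrow> y \<in> S" for S x
    using closed_pcas_closed[OF p(1)] that verts by metis
  define H where "H x y \<longleftrightarrow> (x, y) \<in> set p \<or> (y, x) \<in> set p" for x y
  have card_2: "card {w. H x w} = 2" if x: "x \<in> pverts G" for x
  proof -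
    obtain y z where y: "(x, y) \<in> set p" and z: "(z, x) \<in> set p"
      using x verts snd_verts by force
    have "y \<noteq> z"
    proof
      assume "y = z"
      \<comment> \<open>The arcs \<open>(x, y)\<close> and \<open>(y, x)\<close> would close up,
        making \<open>{x, y}\<close> closed under successors.\<close>
      have "pverts G \<subseteq> {x, y}"
        by (rule closed[of x]) (use x y z \<open>y = z\<close> succ_unique in auto)
      then have "card (pverts G) \<le> card {x, y}"
        by (intro card_mono) auto
      also have "\<dots> \<le> 2"
        by (simp add: card_insert_if)
      finally show False
        using card_verts by simp
    qed
    moreover have "{w. H x w} = {y, z}"
      using y z succ_unique pred_unique by (auto simp: H_def)
    ultimately show ?thesis
      by simp
  qed
  show thesis
  proof
    fix cs assume cs: "distinct cs" "3 \<le> length cs" "set cs \<subseteq> pverts G" "list_all2 H cs (rotate1 cs)"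
    \<comment> \<open>The two neighbours of \<open>x\<close> inside \<open>cs\<close> exhaust its
      degree, so the walk cannot leave \<open>cs\<close>.\<close>
    have "y \<in> set cs" if "x \<in> set cs" "(x, y) \<in> set p" for x y
    proof -
      have "symp H"
        by (auto intro: sympI simp: H_def)
      then obtain a b where "a \<in> set cs" "b \<in> set cs" "a \<noteq> b" "H x a" "H x b"
        using cycle_two_neighbours[OF _ cs(1,2,4) \<open>x \<in> set cs\<close>] by blast
      moreover have "H x y"
        using that by (simp add: H_def)
      ultimately show ?thesis
        using card_2_not_three[OF card_2] that(1) cs(3) by blast
    qed
    moreover have "hd cs \<in> set cs"
      using cs(2) by (intro hd_in_set) auto
    ultimately show "set cs = pverts G"
      using closed cs(3) by blast
  qed (use arcs card_2 in \<open>auto simp: H_def\<close>)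
qed

section \<open>Degree conditions as propositional clauses\<close>

definition exactly_two :: "bool list \<Rightarrow> bool" where
  "exactly_two ps \<longleftrightarrow> length (filter id ps) = 2"

lemma exactly_two_2: "exactly_two [a, b] \<longleftrightarrow> a \<and> b"
  by (simp add: exactly_two_def)

text \<open>Clausal form, as in the two lemmas that follow: at least two of n entries hold iff any n
  - 1 of them include a true one, at most two iff any three include a false one.\<close>

lemma exactly_two_3:
  "exactly_two [a, b, c] \<longleftrightarrow> (a \<or> b) \<and> (a \<or> c) \<and> (b \<or> c) \<and> (\<not> a \<or> \<not> b \<or> \<not> c)"
  by (auto simp: exactly_two_def)

lemma exactly_two_4:
  "exactly_two [a, b, c, d] \<longleftrightarrow>
    (a \<or> b \<or> c) \<and> (a \<or> b \<or> d) \<and> (a \<or> c \<or> d) \<and> (b \<or> c \<or> d) \<and>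
    (\<not> a \<or> \<not> b \<or> \<not> c) \<and> (\<not> a \<or> \<not> b \<or> \<not> d) \<and> (\<not> a \<or> \<not> c \<or> \<not> d) \<and> (\<not> b \<or> \<not> c \<or> \<not> d)"
  by (auto simp: exactly_two_def)

lemma exactly_two_5:
  "exactly_two [a, b, c, d, e] \<longleftrightarrow>
    (a \<or> b \<or> c \<or> d) \<and> (a \<or> b \<or> c \<or> e) \<and> (a \<or> b \<or> d \<or> e) \<and>
    (a \<or> c \<or> d \<or> e) \<and> (b \<or> c \<or> d \<or> e) \<and>
    (\<not> a \<or> \<not> b \<or> \<not> c) \<and> (\<not> a \<or> \<not> b \<or> \<not> d) \<and> (\<not> a \<or> \<not> b \<or> \<not> e) \<and>
    (\<not> a \<or> \<not> c \<or> \<not> d) \<and> (\<not> a \<or> \<not> c \<or> \<not> e) \<and> (\<not> a \<or> \<not> d \<or> \<not> e) \<and>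
    (\<not> b \<or> \<not> c \<or> \<not> d) \<and> (\<not> b \<or> \<not> c \<or> \<not> e) \<and> (\<not> b \<or> \<not> d \<or> \<not> e) \<and>
    (\<not> c \<or> \<not> d \<or> \<not> e)"
  by (auto simp: exactly_two_def)

lemmas exactly_two_simps = exactly_two_2 exactly_two_3 exactly_two_4 exactly_two_5

lemma exactly_two_map:
  assumes "card {y. P y} = 2" "{y. P y} \<subseteq> set ys" "distinct ys"
  shows "exactly_two (map P ys)"
proof -
  have "{y. P y} = set (filter P ys)"
    using assms(2) by auto
  then have "length (filter P ys) = 2"
    using assms(1,3) by (metis distinct_card distinct_filter)
  then show ?thesis
    by (simp add: exactly_two_def filter_map o_def)
qed

text \<open>
  \<open>R v a b\<close> stands for the edge between \<open>\<langle>v, a\<rangle>\<close> and \<open>\<langle>v, b\<rangle>\<close>, and \<open>T u v\<close> for the one between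
  \<open>\<langle>u, v\<rangle>\<close> and \<open>\<langle>v, u\<rangle>\<close>.
\<close>

lemma two_factor_has_short_cycle:
  fixes R :: "nat \<Rightarrow> nat \<Rightarrow> nat \<Rightarrow> bool" and T :: "nat \<Rightarrow> nat \<Rightarrow> bool"
  assumes T_commute: "\<And>u v. T u v \<longleftrightarrow> T v u"
    and rows: "\<And>v. v \<in> {1..9} \<Longrightarrow>
      exactly_two ((if v = 1 then [] else [T v 1]) @ [R v 4 1, R v 1 2]) \<and>
      exactly_two ((if v = 2 then [] else [T v 2]) @ [R v 1 2, R v 2 3]) \<and>
      exactly_two ((if v = 3 then [] else [T v 3]) @ [R v 2 3, R v 3 4]) \<and>
      exactly_two ((if v = 4 then [] else [T v 4]) @ [R v 3 4, R v 4 1, R v 9 4, R v 4 5]) \<and>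
      exactly_two ((if v = 5 then [] else [T v 5]) @ [R v 4 5, R v 5 6]) \<and>
      exactly_two ((if v = 6 then [] else [T v 6]) @ [R v 5 6, R v 6 7]) \<and>
      exactly_two ((if v = 7 then [] else [T v 7]) @ [R v 6 7, R v 7 8]) \<and>
      exactly_two ((if v = 8 then [] else [T v 8]) @ [R v 7 8, R v 8 9]) \<and>
      exactly_two ((if v = 9 then [] else [T v 9]) @ [R v 8 9, R v 9 4])"
    and "\<not> (R 6 1 2 \<and> R 6 2 3 \<and> R 6 3 4 \<and> R 6 4 1)"
    and "\<not> (R 8 1 2 \<and> R 8 2 3 \<and> R 8 3 4 \<and> R 8 4 1)"
    and "\<not> (R 5 8 9 \<and> T 5 9 \<and> R 9 5 6 \<and> T 6 9 \<and> R 6 8 9 \<and> T 6 8 \<and> R 8 5 6 \<and> T 5 8)"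
    and "\<not> (R 5 7 8 \<and> R 5 8 9 \<and> T 5 9 \<and> R 9 5 6 \<and> R 9 6 7 \<and> T 7 9 \<and> R 7 9 4 \<and> R 7 4 5 \<and> T 5 7)"
  shows False
proof -
  note One_nat_def [simp del]
  \<comment> \<open>oriented so that each transposition edge becomes a single propositional atom\<close>
  have T_less: "T u v \<longleftrightarrow> T v u" if "v < u" for u v
    by (rule T_commute)
  note [simp] = T_less exactly_two_simps
  \<comment> \<open>These are the clauses for all 81 vertices; deciding the conditionals drops the
    transposition edge at diagonal vertices.\<close>
  note rows[of 1, simplified] rows[of 2, simplified] rows[of 3, simplified]
    rows[of 4, simplified] rows[of 5, simplified] rows[of 6, simplified]
    rows[of 7, simplified] rows[of 8, simplified] rows[of 9, simplified]
  with assms(3-6) show False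
    by sat
qed

section \<open>Application to the OTIS graph of the bowtie\<close>

theorem mainTheorem5:
  shows "\<not> hamiltonian (with_proj (OTIS bowtie_4_6))"
proof
  let ?G = "OTIS bowtie_4_6"
  note One_nat_def [simp del]
  assume "hamiltonian (with_proj ?G)"
  then obtain H where H_commute: "\<And>x y. H x y \<longleftrightarrow> H y x"
    and edge: "\<And>x y. H x y \<Longrightarrow> (x, y) \<in> parcs ?G \<or> (y, x) \<in> parcs ?G"
    and deg: "\<And>x. x \<in> pverts ?G \<Longrightarrow> card {y. H x y} = 2"
    and cycle: "\<And>cs. distinct cs \<Longrightarrow> 3 \<le> length cs \<Longrightarrow> set cs \<subseteq> pverts ?G \<Longrightarrow>
      list_all2 H cs (rotate1 cs) \<Longrightarrow> set cs = pverts ?G"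
    by (rule hamiltonian_edge_relation) blast
  have verts: "pverts ?G = {1..9} \<times> {1..9}"
    by (simp add: OTIS_def bowtie_4_6_def Let_def)
  \<comment> \<open>An equation between functions also unfolds the partial application in
    \<open>map (R v u) ws\<close>.\<close>
  define R where "R = (\<lambda>v a b. H (v, a) (v, b))"
  define T where "T u v \<longleftrightarrow> H (u, v) (v, u)" for u v
  have R_commute: "R v a b \<longleftrightarrow> R v b a" for v a b
    by (simp add: R_def H_commute)
  interpret bowtie: pair_graph bowtie_4_6
    by (rule pair_graph_bowtie_4_6)
  have bowtie_commute: "(u, w) \<in> parcs bowtie_4_6 \<longleftrightarrow> (w, u) \<in> parcs bowtie_4_6" for u w
    using bowtie.arcs_symmetric by blast
  have nbrs: "{y. H (v, u) y} \<subseteq> set ((if v = u then [] else [(u, v)]) @ map (Pair v) ws)"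
    if "{w. (u, w) \<in> parcs bowtie_4_6} = set ws" for v u ws
  proof -
    have "(u, w) \<in> parcs bowtie_4_6 \<longleftrightarrow> w \<in> set ws" "(w, u) \<in> parcs bowtie_4_6 \<longleftrightarrow> w \<in> set ws" for w
      using that bowtie_commute by blast+
    then show ?thesis
      by (auto simp: OTIS_def dest!: edge)
  qed
  have row: "exactly_two ((if v = u then [] else [T v u]) @ map (R v u) ws)"
    if "v \<in> {1..9}" "u \<in> {1..9}" "{w. (u, w) \<in> parcs bowtie_4_6} = set ws" "distinct ws" for v u ws
  proof -
    have "exactly_two (map (H (v, u)) ((if v = u then [] else [(u, v)]) @ map (Pair v) ws))"
    proof (rule exactly_two_map)
      show "card {y. H (v, u) y} = 2"
        using deg that(1,2) by (simp add: verts)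
      show "{y. H (v, u) y} \<subseteq> set ((if v = u then [] else [(u, v)]) @ map (Pair v) ws)"
        using that(3) by (rule nbrs)
      show "distinct ((if v = u then [] else [(u, v)]) @ map (Pair v) ws)"
        using that(4) by (auto simp: distinct_map inj_on_def)
    qed
    then show ?thesis
      by (simp add: T_def R_def o_def split: if_splits)
  qed
  \<comment> \<open>The neighbours are ordered as in the hypothesis \<open>rows\<close> of
    \<open>two_factor_has_short_cycle\<close>, so the lists match once \<open>R_commute\<close> has
    normalised each edge.\<close>
  have bowtie: "{w. (1, w) \<in> parcs bowtie_4_6} = set [4, 2]"
    "{w. (2, w) \<in> parcs bowtie_4_6} = set [1, 3]"
    "{w. (3, w) \<in> parcs bowtie_4_6} = set [2, 4]"
    "{w. (4, w) \<in> parcs bowtie_4_6} = set [3, 1, 9, 5]"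
    "{w. (5, w) \<in> parcs bowtie_4_6} = set [4, 6]"
    "{w. (6, w) \<in> parcs bowtie_4_6} = set [5, 7]"
    "{w. (7, w) \<in> parcs bowtie_4_6} = set [6, 8]"
    "{w. (8, w) \<in> parcs bowtie_4_6} = set [7, 9]"
    "{w. (9, w) \<in> parcs bowtie_4_6} = set [8, 4]"
    by (auto simp: bowtie_4_6_def Let_def)
  \<comment> \<open>\<open>(9, 9)\<close> lies on none of the four cycles, so none of them can be
    spanning.\<close>
  have no_cycle: "\<not> list_all2 H cs (rotate1 cs)"
    if "distinct cs" "3 \<le> length cs" "set cs \<subseteq> {1..9} \<times> {1..9}" "(9, 9) \<notin> set cs" for cs
    using cycle[of cs] that by (auto simp: verts)
  show False
  proof (rule two_factor_has_short_cycle[of T R], goal_cases)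
    case (1 u v)
    show ?case
      unfolding T_def by (rule H_commute)
  next
    case (2 v)
    show ?case
      using row[OF 2 _ bowtie(1)] row[OF 2 _ bowtie(2)] row[OF 2 _ bowtie(3)]
        row[OF 2 _ bowtie(4)] row[OF 2 _ bowtie(5)] row[OF 2 _ bowtie(6)]
        row[OF 2 _ bowtie(7)] row[OF 2 _ bowtie(8)] row[OF 2 _ bowtie(9)]
      by (simp add: R_commute)
  next
    case 3
    show ?case
      using no_cycle[of "[(6, 1), (6, 2), (6, 3), (6, 4)]"]
      by (simp add: R_def T_def H_commute)
  next
    case 4
    show ?case
      using no_cycle[of "[(8, 1), (8, 2), (8, 3), (8, 4)]"]
      by (simp add: R_def T_def H_commute)
  next
    \<comment> \<open>Row edges over the bowtie edges 5-6 and 8-9 alternate with transposition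
      edges, through the rows 5, 9, 6, 8.\<close>
    case 5
    show ?case
      using no_cycle[of "[(5, 8), (5, 9), (9, 5), (9, 6), (6, 9), (6, 8), (8, 6), (8, 5)]"]
      by (simp add: R_def T_def H_commute)
  next
    \<comment> \<open>The 6-cycle splits into the paths 7-8-9, 5-6-7 and 9-4-5, placed in the rows
      5, 9 and 7 and joined by transposition edges.\<close>
    case 6
    show ?case
      using no_cycle[of "[(5, 7), (5, 8), (5, 9), (9, 5), (9, 6), (9, 7), (7, 9), (7, 4), (7, 5)]"]
      by (simp add: R_def T_def H_commute)
  qed
qed

end
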